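(* Let $i:Z\hookrightarrow X$ be a closed immersion with open complement $j:U\hookrightarrow X$, and assume the recollement axioms for $(i,j)$. Let $A\in\mathcal C(X)$, $d\in\mathbb Z$, and let $c\in H^d(X;A)$ satisfy $j^*c=0$. Then $\mathrm{Lift}_Z^d(c)$ is nonempty. Moreover, it is a torsor under the subgroup $$\ker(\mathrm{forg})=\mathrm{im}\bigl(\delta:H^{d-1}(U;j^*A)\to H_Z^d(X;A)\bigr).$$ In particular, any two supported refinements differ by a unique element of $\mathrm{im}(\delta)$. After adjunction, $\mathrm{Loc}_Z^{\mathrm{tor}}(c)$ is a torsor under the subgroup $\mathrm{adj}(\mathrm{im}(\delta))\subset\mathrm{Hom}_{\mathcal C(Z)}(\mathbf 1_Z,i^!A[d])$.
   Context: Setting: to each space $X$ (in a fixed category of spaces with closed immersions, open complements, Cartesian squares and proper morphisms) is attached a stable triangulated category $\mathcal C(X)$ with a symmetric monoidal structure $(\otimes,\mathbf 1_X)$. Each morphism $f:X\to Y$ has exact functors $f^*\dashv f_*$, with $f^*$ symmetric monoidal, so $f^*\mathbf 1_Y\simeq\mathbf 1_X$. Recollement axioms for a closed immersion $i:Z\hookrightarrow X$ with open complement $j:U=X\setminus Z\hookrightarrow X$: adjunctions $i^*\dashv i_*\dashv i^!$ and $j_!\dashv j^*\dashv j_*$; $i_*$ and $j_!$ are fully faithful; $j^*i_*=0$ and $i^*j_!=0$; and for each $M\in\mathcal C(X)$ functorial distinguished triangles $j_!j^*M\to M\to i_*i^*M\xrightarrow{+1}$ and $i_*i^!M\to M\to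 j_*j^*M\xrightarrow{+1}$, whose maps to and from $M$ are the adjunction counits and units. Definitions: $H^d(X;A)=\mathrm{Hom}_{\mathcal C(X)}(\mathbf 1_X,A[d])$; $H_Z^d(X;A)=\mathrm{Hom}_{\mathcal C(X)}(\mathbf 1_X,i_*i^!A[d])$; $\mathrm{forg}:H_Z^d(X;A)\to H^d(X;A)$ is induced by the counit $i_*i^!A\to A$. Applying $\mathrm{Hom}(\mathbf 1_X,-)$ to $i_*i^!A\to A\to j_*j^*A\xrightarrow{+1}$, and using $\mathrm{Hom}(\mathbf 1_X,j_*j^*A[d])\cong H^d(U;j^*A)$, gives the localisation long exact sequence $\cdots\to H_Z^d(X;A)\xrightarrow{\mathrm{forg}}H^d(X;A)\xrightarrow{j^*}H^d(U;j^*A)\xrightarrow{\delta}H_Z^{d+1}(X;A)\to\cdots$, which defines $j^*$ and $\delta$. The set of supported refinements of $c$ is $\mathrm{Lift}_Z^d(c)=\{\widetilde c\in H_Z^d(X;A)\mid\mathrm{forg}(\widetilde c)=c\}$. Let $\mathrm{adj}:H_Z^d(X;A)=\mathrm{Hom}_{\mathcal C(X)}(\mathbf 1_X,i_*i^!A[d])\cong\mathrm{Hom}_{\mathcal C(Z)}(\mathbf 1_Z,i^!A[d])$ be the adjunction isomorphism (using $i^*\mathbf 1_X\simeq\mathbf 1_Z$). The localisation torsor is $\mathrm{Loc}_Z^{\mathrm{tor}}(c)=\mathrm{adj}(\mathrm{Lift}_Z^d(c))$. *)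

theory Defs
  imports "HOL-Algebra.Group_Action"
begin

section \<open>Categories and functors\<close>

record ('o, 'm) precategory =
  objs :: "'o set"
  arrs :: "'m set"
  src :: "'m \<Rightarrow> 'o"
  tgt :: "'m \<Rightarrow> 'o"
  idt :: "'o \<Rightarrow> 'm"
  cmp :: "'m \<Rightarrow> 'm \<Rightarrow> 'm" (infixl "\<cdot>\<index>" 70)

definition Hom :: "('o, 'm, 'z) precategory_scheme \<Rightarrow> 'o \<Rightarrow> 'o \<Rightarrow> 'm set"
  where "Hom C a b = {f \<in> arrs C. src C f = a \<and> tgt C f = b}"

locale category =
  fixes C :: "('o, 'm, 'z) precategory_scheme" (structure)
  assumes src_tgt: "f \<in> arrs C \<Longrightarrow> src C f \<in> objs C \<and> tgt C f \<in> objs C"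
    and idt_Hom: "a \<in> objs C \<Longrightarrow> idt C a \<in> Hom C a a"
    and cmp_Hom: "\<lbrakk>f \<in> Hom C a b; g \<in> Hom C b c\<rbrakk> \<Longrightarrow> g \<cdot> f \<in> Hom C a c"
    and cmp_idt: "f \<in> Hom C a b \<Longrightarrow> f \<cdot> idt C a = f"
    and idt_cmp: "f \<in> Hom C a b \<Longrightarrow> idt C b \<cdot> f = f"
    and cmp_assoc: "\<lbrakk>f \<in> Hom C a b; g \<in> Hom C b c; h \<in> Hom C c d\<rbrakk>
      \<Longrightarrow> h \<cdot> g \<cdot> f = h \<cdot> (g \<cdot> f)"

definition inverse_arrows :: "('o, 'm, 'z) precategory_scheme \<Rightarrow> 'm \<Rightarrow> 'm \<Rightarrow> bool"
  where "inverse_arrows C f g \<longleftrightarrow>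
    f \<in> arrs C \<and> g \<in> Hom C (tgt C f) (src C f) \<and>
    g \<cdot>\<^bsub>C\<^esub> f = idt C (src C f) \<and> f \<cdot>\<^bsub>C\<^esub> g = idt C (tgt C f)"

definition Iso :: "('o, 'm, 'z) precategory_scheme \<Rightarrow> 'o \<Rightarrow> 'o \<Rightarrow> 'm set"
  where "Iso C a b = {f \<in> Hom C a b. \<exists>g. inverse_arrows C f g}"

definition inv_arr :: "('o, 'm, 'z) precategory_scheme \<Rightarrow> 'm \<Rightarrow> 'm"
  where "inv_arr C f = (THE g. inverse_arrows C f g)"

definition zero_object :: "('o, 'm, 'z) precategory_scheme \<Rightarrow> 'o \<Rightarrow> bool"
  where "zero_object C z \<longleftrightarrow> z \<in> objs C \<and>
    (\<forall>a \<in> objs C. (\<exists>!f. f \<in> Hom C a z) \<and> (\<exists>!f. f \<in> Hom C z a))"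

record ('o, 'm, 'p, 'n) fctr =
  fobj :: "'o \<Rightarrow> 'p"
  farr :: "'m \<Rightarrow> 'n"

locale covariant_functor = C: category C + D: category D
  for C :: "('o, 'm, 'y) precategory_scheme" and D :: "('p, 'n, 'z) precategory_scheme" +
  fixes F :: "('o, 'm, 'p, 'n, 'w) fctr_scheme"
  assumes fobj_objs: "a \<in> objs C \<Longrightarrow> fobj F a \<in> objs D"
    and farr_Hom: "f \<in> Hom C a b \<Longrightarrow> farr F f \<in> Hom D (fobj F a) (fobj F b)"
    and farr_idt: "a \<in> objs C \<Longrightarrow> farr F (idt C a) = idt D (fobj F a)"
    and farr_cmp: "\<lbrakk>f \<in> Hom C a b; g \<in> Hom C b c\<rbrakk>
      \<Longrightarrow> farr F (g \<cdot>\<^bsub>C\<^esub> f) = farr F g \<cdot>\<^bsub>D\<^esub> farr F f"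

definition fully_faithful ::
  "('o, 'm, 'y) precategory_scheme \<Rightarrow> ('p, 'n, 'z) precategory_scheme
    \<Rightarrow> ('o, 'm, 'p, 'n, 'w) fctr_scheme \<Rightarrow> bool"
  where "fully_faithful C D F \<longleftrightarrow>
    (\<forall>a \<in> objs C. \<forall>b \<in> objs C. bij_betw (farr F) (Hom C a b) (Hom D (fobj F a) (fobj F b)))"

text \<open>\<open>F\<close> is left adjoint to \<open>G\<close>, with unit \<open>\<eta>\<close> and counit \<open>\<epsilon>\<close>.\<close>

locale adjunction = F: covariant_functor C D F + G: covariant_functor D C G
  for C :: "('o, 'm, 'y) precategory_scheme" and D :: "('p, 'n, 'z) precategory_scheme"
    and F :: "('o, 'm, 'p, 'n, 'v) fctr_scheme" and G :: "('p, 'n, 'o, 'm, 'w) fctr_scheme" +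
  fixes \<eta> :: "'o \<Rightarrow> 'm" and \<epsilon> :: "'p \<Rightarrow> 'n"
  assumes unit_Hom: "a \<in> objs C \<Longrightarrow> \<eta> a \<in> Hom C a (fobj G (fobj F a))"
    and unit_natural: "f \<in> Hom C a b \<Longrightarrow> farr G (farr F f) \<cdot>\<^bsub>C\<^esub> \<eta> a = \<eta> b \<cdot>\<^bsub>C\<^esub> f"
    and counit_Hom: "p \<in> objs D \<Longrightarrow> \<epsilon> p \<in> Hom D (fobj F (fobj G p)) p"
    and counit_natural: "g \<in> Hom D p q \<Longrightarrow> \<epsilon> q \<cdot>\<^bsub>D\<^esub> farr F (farr G g) = g \<cdot>\<^bsub>D\<^esub> \<epsilon> p"
    and triangle_left: "a \<in> objs C \<Longrightarrow> \<epsilon> (fobj F a) \<cdot>\<^bsub>D\<^esub> farr F (\<eta> a) = idt D (fobj F a)"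
    and triangle_right: "p \<in> objs D \<Longrightarrow> farr G (\<epsilon> p) \<cdot>\<^bsub>C\<^esub> \<eta> (fobj G p) = idt C (fobj G p)"

section \<open>Triangulated categories\<close>

record ('o, 'm) preadditive = "('o, 'm) precategory" +
  add_arr :: "'m \<Rightarrow> 'm \<Rightarrow> 'm"
  zero_arr :: "'o \<Rightarrow> 'o \<Rightarrow> 'm"

text \<open>The abelian group of arrows from \<open>a\<close> to \<open>b\<close>. The group notation of \<open>HOL-Algebra\<close>
  is multiplicative, so \<open>\<otimes>\<close>, \<open>\<one>\<close> and \<open>inv\<close> of this group are addition, zero and negation of
  arrows.\<close>

definition HomG :: "('o, 'm, 'z) preadditive_scheme \<Rightarrow> 'o \<Rightarrow> 'o \<Rightarrow> 'm monoid"
  where "HomG C a b = \<lparr>carrier = Hom C a b, mult = add_arr C, one = zero_arr C a b\<rparr>"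

definition neg_arr :: "('o, 'm, 'z) preadditive_scheme \<Rightarrow> 'm \<Rightarrow> 'm"
  where "neg_arr C f = inv\<^bsub>HomG C (src C f) (tgt C f)\<^esub> f"

locale additive_category = category C
  for C :: "('o, 'm, 'z) preadditive_scheme" (structure) +
  assumes HomG_comm_group: "\<lbrakk>a \<in> objs C; b \<in> objs C\<rbrakk> \<Longrightarrow> comm_group (HomG C a b)"
    and cmp_add_right: "\<lbrakk>f \<in> Hom C a b; f' \<in> Hom C a b; g \<in> Hom C b c\<rbrakk>
      \<Longrightarrow> g \<cdot> add_arr C f f' = add_arr C (g \<cdot> f) (g \<cdot> f')"
    and cmp_add_left: "\<lbrakk>f \<in> Hom C a b; g \<in> Hom C b c; g' \<in> Hom C b c\<rbrakk>
      \<Longrightarrow> add_arr C g g' \<cdot> f = add_arr C (g \<cdot> f) (g' \<cdot> f)"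
    and zero_object_exists: "\<exists>z. zero_object C z"
    and biproduct_exists: "\<lbrakk>a \<in> objs C; b \<in> objs C\<rbrakk> \<Longrightarrow>
      \<exists>s \<in> objs C. \<exists>i1 \<in> Hom C a s. \<exists>i2 \<in> Hom C b s. \<exists>p1 \<in> Hom C s a. \<exists>p2 \<in> Hom C s b.
        p1 \<cdot> i1 = idt C a \<and> p2 \<cdot> i2 = idt C b \<and>
        p2 \<cdot> i1 = zero_arr C a b \<and> p1 \<cdot> i2 = zero_arr C b a \<and>
        add_arr C (i1 \<cdot> p1) (i2 \<cdot> p2) = idt C s"

locale additive_functor =
  covariant_functor C D F + C: additive_category C + D: additive_category D
  for C :: "('o, 'm, 'y) preadditive_scheme" and D :: "('p, 'n, 'z) preadditive_scheme"
    and F :: "('o, 'm, 'p, 'n, 'w) fctr_scheme" +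
  assumes farr_add: "\<lbrakk>f \<in> Hom C a b; g \<in> Hom C a b\<rbrakk>
    \<Longrightarrow> farr F (add_arr C f g) = add_arr D (farr F f) (farr F g)"

text \<open>The shift is a strict action of the integers, \<open>[m] \<circ> [n] = [m + n]\<close>, by additive functors;
  \<open>shobj C n a\<close> is \<open>a[n]\<close> and \<open>sharr C n f\<close> is \<open>f[n]\<close>. A triangle
  \<open>a \<rightarrow> b \<rightarrow> c \<rightarrow> a[1]\<close> is given by its three arrows, which determine the objects.\<close>

record ('o, 'm) pretriangulated = "('o, 'm) preadditive" +
  shobj :: "int \<Rightarrow> 'o \<Rightarrow> 'o"
  sharr :: "int \<Rightarrow> 'm \<Rightarrow> 'm"
  dist :: "('m \<times> 'm \<times> 'm) set"

definition shift :: "('o, 'm, 'z) pretriangulated_scheme \<Rightarrow> int \<Rightarrow> ('o, 'm, 'o, 'm) fctr"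
  where "shift C n = \<lparr>fobj = shobj C n, farr = sharr C n\<rparr>"

definition is_triangle :: "('o, 'm, 'z) pretriangulated_scheme \<Rightarrow> 'm \<Rightarrow> 'm \<Rightarrow> 'm \<Rightarrow> bool"
  where "is_triangle C f g h \<longleftrightarrow>
    f \<in> arrs C \<and> g \<in> Hom C (tgt C f) (src C h) \<and> h \<in> arrs C \<and> tgt C h = shobj C 1 (src C f)"

locale triangulated_category = additive_category C
  for C :: "('o, 'm, 'z) pretriangulated_scheme" (structure) +
  assumes shift_additive: "additive_functor C C (shift C n)"
    and shobj_0: "a \<in> objs C \<Longrightarrow> shobj C 0 a = a"
    and sharr_0: "f \<in> arrs C \<Longrightarrow> sharr C 0 f = f"
    and shobj_shobj: "a \<in> objs C \<Longrightarrow> shobj C m (shobj C n a) = shobj C (m + n) a"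
    and sharr_sharr: "f \<in> arrs C \<Longrightarrow> sharr C m (sharr C n f) = sharr C (m + n) f"
    and dist_triangle: "(f, g, h) \<in> dist C \<Longrightarrow> is_triangle C f g h"
    and dist_iso: "\<lbrakk>(f, g, h) \<in> dist C; is_triangle C f' g' h';
        u \<in> Iso C (src C f) (src C f'); v \<in> Iso C (tgt C f) (tgt C f');
        w \<in> Iso C (src C h) (src C h');
        v \<cdot> f = f' \<cdot> u; w \<cdot> g = g' \<cdot> v; sharr C 1 u \<cdot> h = h' \<cdot> w\<rbrakk>
      \<Longrightarrow> (f', g', h') \<in> dist C"
    and dist_idt: "\<lbrakk>a \<in> objs C; zero_object C z\<rbrakk>
      \<Longrightarrow> (idt C a, zero_arr C a z, zero_arr C z (shobj C 1 a)) \<in> dist C"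
    and dist_complete: "f \<in> arrs C \<Longrightarrow> \<exists>g h. (f, g, h) \<in> dist C"
    and dist_rotate: "is_triangle C f g h
      \<Longrightarrow> (f, g, h) \<in> dist C \<longleftrightarrow> (g, h, neg_arr C (sharr C 1 f)) \<in> dist C"
    and dist_morphism: "\<lbrakk>(f, g, h) \<in> dist C; (f', g', h') \<in> dist C;
        u \<in> Hom C (src C f) (src C f'); v \<in> Hom C (tgt C f) (tgt C f'); v \<cdot> f = f' \<cdot> u\<rbrakk>
      \<Longrightarrow> \<exists>w \<in> Hom C (src C h) (src C h'). w \<cdot> g = g' \<cdot> v \<and> sharr C 1 u \<cdot> h = h' \<cdot> w"
    and octahedral: "\<lbrakk>f \<in> Hom C x y; g \<in> Hom C y z;
        (f, p1, d1) \<in> dist C; (g \<cdot> f, p2, d2) \<in> dist C; (g, p3, d3) \<in> dist C\<rbrakk>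
      \<Longrightarrow> \<exists>a b. (a, b, sharr C 1 p1 \<cdot> d3) \<in> dist C \<and>
          a \<in> Hom C (src C d1) (src C d2) \<and> b \<in> Hom C (src C d2) (src C d3) \<and>
          a \<cdot> p1 = p2 \<cdot> g \<and> d2 \<cdot> a = d1 \<and> b \<cdot> p2 = p3 \<and> d3 \<cdot> b = sharr C 1 f \<cdot> d2"

text \<open>Part of an exact functor \<open>F\<close> is a natural isomorphism
  \<open>shcmp F n a : F (a[n]) \<rightarrow> (F a)[n]\<close>. It is given for all \<open>n\<close> at once, subject to the cocycle
  condition; it is determined by its component \<open>n = 1\<close>.\<close>

record ('o, 'm, 'p, 'n) exact_fctr = "('o, 'm, 'p, 'n) fctr" +
  shcmp :: "int \<Rightarrow> 'o \<Rightarrow> 'n"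

locale exact_functor =
  additive_functor C D F + C: triangulated_category C + D: triangulated_category D
  for C :: "('o, 'm, 'y) pretriangulated_scheme" and D :: "('p, 'n, 'z) pretriangulated_scheme"
    and F :: "('o, 'm, 'p, 'n, 'w) exact_fctr_scheme" +
  assumes shcmp_Iso: "a \<in> objs C
      \<Longrightarrow> shcmp F n a \<in> Iso D (fobj F (shobj C n a)) (shobj D n (fobj F a))"
    and shcmp_natural: "f \<in> Hom C a b
      \<Longrightarrow> shcmp F n b \<cdot>\<^bsub>D\<^esub> farr F (sharr C n f) = sharr D n (farr F f) \<cdot>\<^bsub>D\<^esub> shcmp F n a"
    and shcmp_0: "a \<in> objs C \<Longrightarrow> shcmp F 0 a = idt D (fobj F a)"
    and shcmp_add: "a \<in> objs C
      \<Longrightarrow> shcmp F (m + n) a = sharr D n (shcmp F m a) \<cdot>\<^bsub>D\<^esub> shcmp F n (shobj C m a)"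
    and farr_dist: "(f, g, h) \<in> dist C
      \<Longrightarrow> (farr F f, farr F g, shcmp F 1 (src C f) \<cdot>\<^bsub>D\<^esub> farr F h) \<in> dist D"

section \<open>Symmetric monoidal structures\<close>

record ('o, 'm) tensor_triangulated = "('o, 'm) pretriangulated" +
  tobj :: "'o \<Rightarrow> 'o \<Rightarrow> 'o"
  tarr :: "'m \<Rightarrow> 'm \<Rightarrow> 'm"
  tunit :: "'o"
  tassoc :: "'o \<Rightarrow> 'o \<Rightarrow> 'o \<Rightarrow> 'm"
  lunit :: "'o \<Rightarrow> 'm"
  runit :: "'o \<Rightarrow> 'm"
  braid :: "'o \<Rightarrow> 'o \<Rightarrow> 'm"

locale symmetric_monoidal_category = category C
  for C :: "('o, 'm, 'z) tensor_triangulated_scheme" (structure) +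
  assumes tobj_objs: "\<lbrakk>a \<in> objs C; b \<in> objs C\<rbrakk> \<Longrightarrow> tobj C a b \<in> objs C"
    and tarr_Hom: "\<lbrakk>f \<in> Hom C a b; g \<in> Hom C c d\<rbrakk> \<Longrightarrow> tarr C f g \<in> Hom C (tobj C a c) (tobj C b d)"
    and tarr_idt: "\<lbrakk>a \<in> objs C; b \<in> objs C\<rbrakk> \<Longrightarrow> tarr C (idt C a) (idt C b) = idt C (tobj C a b)"
    and tarr_cmp: "\<lbrakk>f \<in> Hom C a b; f' \<in> Hom C b c; g \<in> Hom C a' b'; g' \<in> Hom C b' c'\<rbrakk>
      \<Longrightarrow> tarr C (f' \<cdot> f) (g' \<cdot> g) = tarr C f' g' \<cdot> tarr C f g"
    and tunit_objs: "tunit C \<in> objs C"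
    and tassoc_Iso: "\<lbrakk>a \<in> objs C; b \<in> objs C; c \<in> objs C\<rbrakk>
      \<Longrightarrow> tassoc C a b c \<in> Iso C (tobj C (tobj C a b) c) (tobj C a (tobj C b c))"
    and tassoc_natural: "\<lbrakk>f \<in> Hom C a a'; g \<in> Hom C b b'; h \<in> Hom C c c'\<rbrakk>
      \<Longrightarrow> tassoc C a' b' c' \<cdot> tarr C (tarr C f g) h = tarr C f (tarr C g h) \<cdot> tassoc C a b c"
    and lunit_Iso: "a \<in> objs C \<Longrightarrow> lunit C a \<in> Iso C (tobj C (tunit C) a) a"
    and lunit_natural: "f \<in> Hom C a b
      \<Longrightarrow> lunit C b \<cdot> tarr C (idt C (tunit C)) f = f \<cdot> lunit C a"
    and runit_Iso: "a \<in> objs C \<Longrightarrow> runit C a \<in> Iso C (tobj C a (tunit C)) a"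
    and runit_natural: "f \<in> Hom C a b
      \<Longrightarrow> runit C b \<cdot> tarr C f (idt C (tunit C)) = f \<cdot> runit C a"
    and braid_Iso: "\<lbrakk>a \<in> objs C; b \<in> objs C\<rbrakk> \<Longrightarrow> braid C a b \<in> Iso C (tobj C a b) (tobj C b a)"
    and braid_natural: "\<lbrakk>f \<in> Hom C a a'; g \<in> Hom C b b'\<rbrakk>
      \<Longrightarrow> braid C a' b' \<cdot> tarr C f g = tarr C g f \<cdot> braid C a b"
    and pentagon: "\<lbrakk>a \<in> objs C; b \<in> objs C; c \<in> objs C; d \<in> objs C\<rbrakk>
      \<Longrightarrow> tassoc C a b (tobj C c d) \<cdot> tassoc C (tobj C a b) c d
        = tarr C (idt C a) (tassoc C b c d) \<cdot> tassoc C a (tobj C b c) d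
          \<cdot> tarr C (tassoc C a b c) (idt C d)"
    and unit_triangle: "\<lbrakk>a \<in> objs C; b \<in> objs C\<rbrakk>
      \<Longrightarrow> tarr C (idt C a) (lunit C b) \<cdot> tassoc C a (tunit C) b = tarr C (runit C a) (idt C b)"
    and hexagon: "\<lbrakk>a \<in> objs C; b \<in> objs C; c \<in> objs C\<rbrakk>
      \<Longrightarrow> tassoc C b c a \<cdot> braid C a (tobj C b c) \<cdot> tassoc C a b c
        = tarr C (idt C b) (braid C a c) \<cdot> tassoc C b a c \<cdot> tarr C (braid C a b) (idt C c)"
    and braid_braid: "\<lbrakk>a \<in> objs C; b \<in> objs C\<rbrakk>
      \<Longrightarrow> braid C b a \<cdot> braid C a b = idt C (tobj C a b)"

text \<open>A (strong) symmetric monoidal exact functor, with structure isomorphisms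
  \<open>\<one> \<rightarrow> F \<one>\<close> and \<open>F a \<otimes> F b \<rightarrow> F (a \<otimes> b)\<close>.\<close>

record ('o, 'm, 'p, 'n) tensor_fctr = "('o, 'm, 'p, 'n) exact_fctr" +
  unitcmp :: "'n"
  tenscmp :: "'o \<Rightarrow> 'o \<Rightarrow> 'n"

locale symmetric_monoidal_functor =
  covariant_functor C D F + C: symmetric_monoidal_category C + D: symmetric_monoidal_category D
  for C :: "('o, 'm, 'y) tensor_triangulated_scheme"
    and D :: "('p, 'n, 'z) tensor_triangulated_scheme"
    and F :: "('o, 'm, 'p, 'n, 'w) tensor_fctr_scheme" +
  assumes unitcmp_Iso: "unitcmp F \<in> Iso D (tunit D) (fobj F (tunit C))"
    and tenscmp_Iso: "\<lbrakk>a \<in> objs C; b \<in> objs C\<rbrakk>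
      \<Longrightarrow> tenscmp F a b \<in> Iso D (tobj D (fobj F a) (fobj F b)) (fobj F (tobj C a b))"
    and tenscmp_natural: "\<lbrakk>f \<in> Hom C a a'; g \<in> Hom C b b'\<rbrakk>
      \<Longrightarrow> tenscmp F a' b' \<cdot>\<^bsub>D\<^esub> tarr D (farr F f) (farr F g)
        = farr F (tarr C f g) \<cdot>\<^bsub>D\<^esub> tenscmp F a b"
    and tenscmp_assoc: "\<lbrakk>a \<in> objs C; b \<in> objs C; c \<in> objs C\<rbrakk>
      \<Longrightarrow> farr F (tassoc C a b c) \<cdot>\<^bsub>D\<^esub> tenscmp F (tobj C a b) c
            \<cdot>\<^bsub>D\<^esub> tarr D (tenscmp F a b) (idt D (fobj F c))
        = tenscmp F a (tobj C b c) \<cdot>\<^bsub>D\<^esub> tarr D (idt D (fobj F a)) (tenscmp F b c)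
            \<cdot>\<^bsub>D\<^esub> tassoc D (fobj F a) (fobj F b) (fobj F c)"
    and tenscmp_lunit: "a \<in> objs C
      \<Longrightarrow> farr F (lunit C a) \<cdot>\<^bsub>D\<^esub> tenscmp F (tunit C) a
            \<cdot>\<^bsub>D\<^esub> tarr D (unitcmp F) (idt D (fobj F a)) = lunit D (fobj F a)"
    and tenscmp_runit: "a \<in> objs C
      \<Longrightarrow> farr F (runit C a) \<cdot>\<^bsub>D\<^esub> tenscmp F a (tunit C)
            \<cdot>\<^bsub>D\<^esub> tarr D (idt D (fobj F a)) (unitcmp F) = runit D (fobj F a)"
    and tenscmp_braid: "\<lbrakk>a \<in> objs C; b \<in> objs C\<rbrakk>
      \<Longrightarrow> farr F (braid C a b) \<cdot>\<^bsub>D\<^esub> tenscmp F a b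
        = tenscmp F b a \<cdot>\<^bsub>D\<^esub> braid D (fobj F a) (fobj F b)"

section \<open>Coefficient systems and recollements\<close>

text \<open>No compatibility is assumed between the units and counits of \<open>f\<^sup>* \<stileturn> f\<^sub>*\<close> and the
  isomorphisms \<open>shcmp\<close>, nor between the tensor product and the shift or the triangles.\<close>

text \<open>\<open>Sh S X\<close> is the category attached to the space \<open>X\<close>, and \<open>pull S f\<close>, \<open>push S f\<close> are
  \<open>f\<^sup>*\<close>, \<open>f\<^sub>*\<close>. All \<open>Sh S X\<close> live on the same types \<open>'o\<close>, \<open>'m\<close>, but their carriers and
  structure vary freely with \<open>X\<close>. Spaces are objects of an abstract category, so
  being a closed immersion, and \<open>j\<close> being the open complement of \<open>i\<close>, are primitive data.\<close>

record ('s, 'f, 'o, 'm) coefficients =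
  spaces :: "('s, 'f) precategory"
  closed_imm :: "'f set"
  open_compl :: "('f \<times> 'f) set"
  Sh :: "'s \<Rightarrow> ('o, 'm) tensor_triangulated"
  pull :: "'f \<Rightarrow> ('o, 'm, 'o, 'm) tensor_fctr"
  push :: "'f \<Rightarrow> ('o, 'm, 'o, 'm) exact_fctr"
  pp_unit :: "'f \<Rightarrow> 'o \<Rightarrow> 'm"
  pp_counit :: "'f \<Rightarrow> 'o \<Rightarrow> 'm"

locale coefficient_system =
  fixes S :: "('s, 'f, 'o, 'm) coefficients"
  assumes spaces_category: "category (spaces S)"
    and closed_imm_arrs: "closed_imm S \<subseteq> arrs (spaces S)"
    and open_compl_arrs: "(i, j) \<in> open_compl S \<Longrightarrow>
      i \<in> closed_imm S \<and> j \<in> arrs (spaces S) \<and> tgt (spaces S) j = tgt (spaces S) i"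
    and Sh_triangulated: "X \<in> objs (spaces S) \<Longrightarrow> triangulated_category (Sh S X)"
    and Sh_monoidal: "X \<in> objs (spaces S) \<Longrightarrow> symmetric_monoidal_category (Sh S X)"
    and pull_exact: "f \<in> Hom (spaces S) X Y \<Longrightarrow> exact_functor (Sh S Y) (Sh S X) (pull S f)"
    and pull_monoidal: "f \<in> Hom (spaces S) X Y
      \<Longrightarrow> symmetric_monoidal_functor (Sh S Y) (Sh S X) (pull S f)"
    and push_exact: "f \<in> Hom (spaces S) X Y \<Longrightarrow> exact_functor (Sh S X) (Sh S Y) (push S f)"
    and pull_push_adjunction: "f \<in> Hom (spaces S) X Y \<Longrightarrow>
      adjunction (Sh S Y) (Sh S X) (pull S f) (push S f) (pp_unit S f) (pp_counit S f)"

text \<open>The data of a recollement for \<open>i : Z \<rightarrow> X\<close> and \<open>j : U \<rightarrow> X\<close> beyond \<open>i\<^sup>*, i\<^sub>*, j\<^sup>*, j\<^sub>*\<close>: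
  the functors \<open>i\<^sup>!\<close> and \<open>j\<^sub>!\<close>, the units and counits of \<open>i\<^sub>* \<stileturn> i\<^sup>!\<close> and \<open>j\<^sub>! \<stileturn> j\<^sup>*\<close>, and the
  boundary maps \<open>i\<^sub>* i\<^sup>* M \<rightarrow> (j\<^sub>! j\<^sup>* M)[1]\<close> and \<open>j\<^sub>* j\<^sup>* M \<rightarrow> (i\<^sub>* i\<^sup>! M)[1]\<close>.\<close>

record ('o, 'm) recollement_data =
  ishriek :: "('o, 'm, 'o, 'm) fctr"
  jshriek :: "('o, 'm, 'o, 'm) fctr"
  i_unit :: "'o \<Rightarrow> 'm"
  i_counit :: "'o \<Rightarrow> 'm"
  j_unit :: "'o \<Rightarrow> 'm"
  j_counit :: "'o \<Rightarrow> 'm"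
  bdry_low :: "'o \<Rightarrow> 'm"
  bdry_up :: "'o \<Rightarrow> 'm"

locale recollement =
  fixes S :: "('s, 'f, 'o, 'm) coefficients" and i j :: 'f and R :: "('o, 'm) recollement_data"
    and CX CZ CU :: "('o, 'm) tensor_triangulated"
  defines "CX \<equiv> Sh S (tgt (spaces S) i)"
    and "CZ \<equiv> Sh S (src (spaces S) i)"
    and "CU \<equiv> Sh S (src (spaces S) j)"
  assumes i_adjunction:
      "adjunction CZ CX (push S i) (ishriek R) (i_unit R) (i_counit R)"
    and j_adjunction:
      "adjunction CU CX (jshriek R) (pull S j) (j_unit R) (j_counit R)"
    and i_push_ff: "fully_faithful CZ CX (push S i)"
    and jshriek_ff: "fully_faithful CU CX (jshriek R)"
    and pull_j_push_i: "N \<in> objs CZ \<Longrightarrow> zero_object CU (fobj (pull S j) (fobj (push S i) N))"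
    and pull_i_jshriek: "N \<in> objs CU \<Longrightarrow> zero_object CZ (fobj (pull S i) (fobj (jshriek R) N))"
    and low_dist: "M \<in> objs CX \<Longrightarrow> (j_counit R M, pp_unit S i M, bdry_low R M) \<in> dist CX"
    and low_natural: "f \<in> Hom CX M N \<Longrightarrow>
      bdry_low R N \<cdot>\<^bsub>CX\<^esub> farr (push S i) (farr (pull S i) f)
        = sharr CX 1 (farr (jshriek R) (farr (pull S j) f)) \<cdot>\<^bsub>CX\<^esub> bdry_low R M"
    and up_dist: "M \<in> objs CX \<Longrightarrow> (i_counit R M, pp_unit S j M, bdry_up R M) \<in> dist CX"
    and up_natural: "f \<in> Hom CX M N \<Longrightarrow>
      bdry_up R N \<cdot>\<^bsub>CX\<^esub> farr (push S j) (farr (pull S j) f)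
        = sharr CX 1 (farr (push S i) (farr (ishriek R) f)) \<cdot>\<^bsub>CX\<^esub> bdry_up R M"

section \<open>Cohomology with supports\<close>

text \<open>\<open>coh (Sh S X) A d\<close> is the group \<open>H\<^sup>d(X; A)\<close>.\<close>

definition coh :: "('o, 'm, 'z) tensor_triangulated_scheme \<Rightarrow> 'o \<Rightarrow> int \<Rightarrow> 'm monoid"
  where "coh C A d = HomG C (tunit C) (shobj C d A)"

definition cohomology ::
  "('s, 'f, 'o, 'm) coefficients \<Rightarrow> 's \<Rightarrow> 'o \<Rightarrow> int \<Rightarrow> 'm monoid"
  where "cohomology S X A d = coh (Sh S X) A d"

text \<open>\<open>i\<^sub>* i\<^sup>! A[d]\<close> is read as \<open>(i\<^sub>* i\<^sup>! A)[d]\<close>.\<close>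

definition supp_cohomology ::
  "('s, 'f, 'o, 'm) coefficients \<Rightarrow> 'f \<Rightarrow> ('o, 'm) recollement_data \<Rightarrow> 'o \<Rightarrow> int \<Rightarrow> 'm monoid"
  where "supp_cohomology S i R A d =
    coh (Sh S (tgt (spaces S) i)) (fobj (push S i) (fobj (ishriek R) A)) d"

definition forg ::
  "('s, 'f, 'o, 'm) coefficients \<Rightarrow> 'f \<Rightarrow> ('o, 'm) recollement_data \<Rightarrow> 'o \<Rightarrow> int \<Rightarrow> 'm \<Rightarrow> 'm"
  where "forg S i R A d x =
    (let C = Sh S (tgt (spaces S) i) in sharr C d (i_counit R A) \<cdot>\<^bsub>C\<^esub> x)"

text \<open>For \<open>f : Y \<rightarrow> X\<close> and \<open>B\<close> on \<open>Y\<close>, the isomorphism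
  \<open>Hom(\<one>\<^sub>X, (f\<^sub>* B)[d]) \<cong> Hom(\<one>\<^sub>X, f\<^sub>* (B[d])) \<cong> Hom(f\<^sup>* \<one>\<^sub>X, B[d]) \<cong> Hom(\<one>\<^sub>Y, B[d])\<close>.\<close>

definition adj_transpose :: "('s, 'f, 'o, 'm) coefficients \<Rightarrow> 'f \<Rightarrow> 'o \<Rightarrow> int \<Rightarrow> 'm \<Rightarrow> 'm"
  where "adj_transpose S f B d x =
    (let C = Sh S (tgt (spaces S) f); D = Sh S (src (spaces S) f) in
      pp_counit S f (shobj D d B)
        \<cdot>\<^bsub>D\<^esub> farr (pull S f) (inv_arr C (shcmp (push S f) d B) \<cdot>\<^bsub>C\<^esub> x)
        \<cdot>\<^bsub>D\<^esub> unitcmp (pull S f))"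

definition adj ::
  "('s, 'f, 'o, 'm) coefficients \<Rightarrow> 'f \<Rightarrow> ('o, 'm) recollement_data \<Rightarrow> 'o \<Rightarrow> int \<Rightarrow> 'm \<Rightarrow> 'm"
  where "adj S i R A d = adj_transpose S i (fobj (ishriek R) A) d"

definition restrict_coh :: "('s, 'f, 'o, 'm) coefficients \<Rightarrow> 'f \<Rightarrow> 'o \<Rightarrow> int \<Rightarrow> 'm \<Rightarrow> 'm"
  where "restrict_coh S j A d x =
    (let C = Sh S (tgt (spaces S) j) in
      adj_transpose S j (fobj (pull S j) A) d (sharr C d (pp_unit S j A) \<cdot>\<^bsub>C\<^esub> x))"

text \<open>The boundary map \<open>H\<^sup>e(U; j\<^sup>* A) \<rightarrow> H\<^sub>Z\<^bsup>e+1\<^esup>(X; A)\<close>. It is induced by the \<open>e\<close>-th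
  shift of \<open>bdry_up R A\<close> without the sign \<open>(-1)\<^sup>e\<close> that some conventions insert.\<close>

definition bdry ::
  "('s, 'f, 'o, 'm) coefficients \<Rightarrow> 'f \<Rightarrow> ('o, 'm) recollement_data \<Rightarrow> 'o \<Rightarrow> int \<Rightarrow> 'm \<Rightarrow> 'm"
  where "bdry S j R A e y =
    (let C = Sh S (tgt (spaces S) j); B = fobj (pull S j) A in
      sharr C e (bdry_up R A)
        \<cdot>\<^bsub>C\<^esub> the_inv_into (carrier (coh C (fobj (push S j) B) e)) (adj_transpose S j B e) y)"

definition Lift ::
  "('s, 'f, 'o, 'm) coefficients \<Rightarrow> 'f \<Rightarrow> ('o, 'm) recollement_data \<Rightarrow> 'o \<Rightarrow> int \<Rightarrow> 'm \<Rightarrow> 'm set"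
  where "Lift S i R A d c = {x \<in> carrier (supp_cohomology S i R A d). forg S i R A d x = c}"

definition Loc_tor ::
  "('s, 'f, 'o, 'm) coefficients \<Rightarrow> 'f \<Rightarrow> ('o, 'm) recollement_data \<Rightarrow> 'o \<Rightarrow> int \<Rightarrow> 'm \<Rightarrow> 'm set"
  where "Loc_tor S i R A d c = adj S i R A d ` Lift S i R A d c"

definition ker_forg ::
  "('s, 'f, 'o, 'm) coefficients \<Rightarrow> 'f \<Rightarrow> ('o, 'm) recollement_data \<Rightarrow> 'o \<Rightarrow> int \<Rightarrow> 'm set"
  where "ker_forg S i R A d =
    kernel (supp_cohomology S i R A d) (cohomology S (tgt (spaces S) i) A d) (forg S i R A d)"

definition im_bdry ::
  "('s, 'f, 'o, 'm) coefficients \<Rightarrow> 'f \<Rightarrow> ('o, 'm) recollement_data \<Rightarrow> 'o \<Rightarrow> int \<Rightarrow> 'm set"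
  where "im_bdry S j R A e =
    bdry S j R A e ` carrier (cohomology S (src (spaces S) j) (fobj (pull S j) A) e)"

section \<open>Torsors\<close>

definition torsor :: "('g, 'z) monoid_scheme \<Rightarrow> 'e set \<Rightarrow> ('g \<Rightarrow> 'e \<Rightarrow> 'e) \<Rightarrow> bool"
  where "torsor G E \<phi> \<longleftrightarrow>
    transitive_action G E \<phi> \<and> E \<noteq> {} \<and> (\<forall>x \<in> E. stabilizer G \<phi> x = {\<one>\<^bsub>G\<^esub>})"

text \<open>\<open>E\<close> is a torsor under the subgroup \<open>K\<close> of \<open>G\<close>, acting by translation in \<open>G\<close>. The action
  maps are restricted to \<open>E\<close> because the elements of \<open>BijGroup E\<close> are extensional.\<close>

definition translation_torsor :: "('g, 'z) monoid_scheme \<Rightarrow> 'g set \<Rightarrow> 'g set \<Rightarrow> bool"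
  where "translation_torsor G K E \<longleftrightarrow>
    subgroup K G \<and> E \<subseteq> carrier G \<and>
    torsor (G\<lparr>carrier := K\<rparr>) E (\<lambda>k. \<lambda>x \<in> E. k \<otimes>\<^bsub>G\<^esub> x)"

end

theory Submission
  imports Defs
begin

text \<open>Applying \<open>Hom(\<one>, -)\<close> to the triangle \<open>i\<^sub>* i\<^sup>! A \<rightarrow> A \<rightarrow> j\<^sub>* j\<^sup>* A \<rightarrow>\<close> gives an exact
  sequence. Exactness at \<open>H\<^sup>d(X; A)\<close> yields a lift of \<open>c\<close>, and exactness at
  \<open>H\<^sub>Z\<^sup>d(X; A)\<close> identifies the kernel of \<open>forg\<close> with the image of the boundary map. The set of
  lifts is a fibre of a homomorphism, hence a coset of its kernel, and \<open>adj\<close> is an isomorphism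
  of groups, so it carries this coset to a coset. Shifted triangles need no sign bookkeeping:
  exactness in degree \<open>d\<close> is exactness of \<open>Hom(\<one>[-d], -)\<close> in degree \<open>0\<close>.\<close>

section \<open>Cosets as torsors\<close>

text \<open>Left translation by \<open>K\<close> preserves a right coset;
  \<open>b \<otimes> inv a\<close> carries \<open>a \<otimes> x\<close> to
  \<open>b \<otimes> x\<close>, and cancelling \<open>y\<close> makes stabilizers trivial.\<close>

lemma (in group) translation_torsor_r_coset:
  assumes K: "subgroup K G" and x: "x \<in> carrier G"
  shows "translation_torsor G K (K #> x)"
proof -
  interpret K: subgroup K G by fact
  let ?E = "K #> x"
  let ?act = "\<lambda>k. \<lambda>y \<in> ?E. k \<otimes> y"
  let ?K = "G\<lparr>carrier := K\<rparr>"
  have sub: "?E \<subseteq> carrier G"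
    by (rule r_coset_subset_G[OF K.subset x])
  have closed: "k \<otimes> y \<in> ?E" if "k \<in> K" "y \<in> ?E" for k y
    using that x by (auto simp: r_coset_def m_assoc[symmetric])
  have Bij: "?act k \<in> Bij ?E" if k: "k \<in> K" for k
  proof -
    have "bij_betw (?act k) ?E ?E"
    proof (rule bij_betw_byWitness[where f' = "\<lambda>y. inv k \<otimes> y"])
      show "\<forall>y \<in> ?E. inv k \<otimes> ?act k y = y"
        using k sub by (auto simp: m_assoc[symmetric])
      show "\<forall>y \<in> ?E. ?act k (inv k \<otimes> y) = y"
        using k sub closed by (auto simp: m_assoc[symmetric])
    qed (use k closed in auto)
    then show ?thesis by (simp add: Bij_def)
  qed
  have "group_hom ?K (BijGroup ?E) ?act"
  proof (rule group_hom.intro)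
    show "group ?K" by (rule K.subgroup_is_group[OF is_group])
    show "group (BijGroup ?E)" by (rule group_BijGroup)
    \<comment> \<open>Multiplication in \<open>BijGroup\<close> is \<open>compose\<close>, which is
      extensional as well, so both sides agree also outside the coset, where they are
      \<open>undefined\<close>.\<close>
    have "?act (k \<otimes> l) = compose ?E (?act k) (?act l)" if "k \<in> K" "l \<in> K" for k l
      using that sub closed by (auto simp: compose_def m_assoc subset_iff)
    then show "group_hom_axioms ?K (BijGroup ?E) ?act"
      using Bij by (auto simp: group_hom_axioms_def hom_def BijGroup_def)
  qed
  moreover have "\<exists>k \<in> K. ?act k y = z" if y: "y \<in> ?E" and z: "z \<in> ?E" for y z
  proof -
    obtain a b where ab: "a \<in> K" "b \<in> K" "y = a \<otimes> x" "z = b \<otimes> x"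
      using y z by (auto simp: r_coset_def)
    have "(b \<otimes> inv a) \<otimes> y = z"
      using ab x by (simp add: m_assoc[symmetric]) (simp add: m_assoc)
    with ab y show ?thesis by (intro bexI[of _ "b \<otimes> inv a"]) auto
  qed
  ultimately have "transitive_action ?K ?E ?act"
    by (simp add: transitive_action_def transitive_action_axioms_def group_action_def)
  moreover have "x \<in> ?E" by (rule rcos_self[OF x K])
  moreover have "stabilizer ?K ?act y = {\<one>}" if y: "y \<in> ?E" for y
  proof -
    have "k = \<one>" if "k \<in> K" "k \<otimes> y = y" for k
      using that y sub by (metis K.mem_carrier r_cancel_one subsetD)
    then show ?thesis using y sub by (auto simp: stabilizer_def)
  qed
  ultimately show ?thesis
    unfolding translation_torsor_def torsor_def using K sub by auto
qed

text \<open>If \<open>h y = h x\<close> then \<open>y \<otimes> inv x\<close> lies in the kernel,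
  and multiplying by \<open>x\<close> recovers \<open>y\<close>; conversely kernel factors disappear
  under \<open>h\<close>.\<close>

lemma (in group_hom) fibre_eq_kernel_coset:
  assumes x: "x \<in> carrier G"
  shows "{y \<in> carrier G. h y = h x} = kernel G H h #> x"
proof (intro equalityI subsetI)
  fix y assume "y \<in> {y \<in> carrier G. h y = h x}"
  then have y: "y \<in> carrier G" "h y = h x" by auto
  have "y \<otimes> inv x \<in> kernel G H h"
    using x y by (simp add: kernel_def)
  moreover have "y = (y \<otimes> inv x) \<otimes> x"
    using x y by (simp add: G.m_assoc)
  ultimately show "y \<in> kernel G H h #> x"
    unfolding r_coset_def by blast
next
  fix y assume "y \<in> kernel G H h #> x"
  then show "y \<in> {y \<in> carrier G. h y = h x}"
    using x by (auto simp: r_coset_def kernel_def)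
qed

text \<open>Carries the description of the lifts as a coset over to their images under
  \<open>adj\<close>.\<close>

lemma (in group_hom) image_r_coset:
  assumes "K \<subseteq> carrier G" "x \<in> carrier G"
  shows "h ` (K #> x) = h ` K #>\<^bsub>H\<^esub> h x"
  using assms by (auto simp: r_coset_def image_iff subset_iff)

section \<open>Isomorphisms and groups of arrows\<close>

lemma Hom_objs:
  assumes "category C" "f \<in> Hom C a b"
  shows "a \<in> objs C" "b \<in> objs C"
  using category.src_tgt[OF assms(1)] assms(2) by (auto simp: Hom_def)

lemma (in category) inverse_arrows_unique:
  assumes "inverse_arrows C f g" "inverse_arrows C f g'"
  shows "g = g'"
proof -
  let ?a = "src C f" and ?b = "tgt C f"
  have f: "f \<in> Hom C ?a ?b" and g: "g \<in> Hom C ?b ?a" and g': "g' \<in> Hom C ?b ?a"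
    using assms by (auto simp: inverse_arrows_def Hom_def)
  have "g = g \<cdot> (f \<cdot> g')"
    using assms cmp_idt[OF g] by (simp add: inverse_arrows_def)
  also have "\<dots> = g \<cdot> f \<cdot> g'" by (rule cmp_assoc[OF g' f g, symmetric])
  also have "\<dots> = g'"
    using assms idt_cmp[OF g'] by (simp add: inverse_arrows_def)
  finally show ?thesis .
qed

text \<open>\<open>inv_arr\<close> is a definite description, so its properties rest on the
  uniqueness of two-sided inverses.\<close>

lemma (in category) inv_arr_Iso:
  assumes "f \<in> Iso C a b"
  shows "inv_arr C f \<in> Hom C b a" "inv_arr C f \<cdot> f = idt C a" "f \<cdot> inv_arr C f = idt C b"
proof -
  obtain g where g: "inverse_arrows C f g" and f: "f \<in> Hom C a b"
    using assms by (auto simp: Iso_def)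
  have "inv_arr C f = g"
    unfolding inv_arr_def using g inverse_arrows_unique by blast
  then show "inv_arr C f \<in> Hom C b a" "inv_arr C f \<cdot> f = idt C a" "f \<cdot> inv_arr C f = idt C b"
    using g f by (auto simp: inverse_arrows_def Hom_def)
qed

lemma (in category) Iso_Hom: "f \<in> Iso C a b \<Longrightarrow> f \<in> Hom C a b"
  by (simp add: Iso_def)

text \<open>Serves to undo the comparison \<open>shcmp\<close> of a pushforward with the shift, the
  first step of \<open>adj_transpose\<close>.\<close>

lemma (in category) inv_arr_postcmp_bij:
  assumes f: "f \<in> Iso C b c" and a: "a \<in> objs C"
  shows "bij_betw (\<lambda>x. inv_arr C f \<cdot> x) (Hom C a c) (Hom C a b)"
proof (rule bij_betw_byWitness[where f' = "\<lambda>x. f \<cdot> x"])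
  note i = inv_arr_Iso[OF f] and f' = Iso_Hom[OF f]
  show "\<forall>x \<in> Hom C a c. f \<cdot> (inv_arr C f \<cdot> x) = x"
    using cmp_assoc[OF _ i(1) f'] i(3) idt_cmp by metis
  show "\<forall>x \<in> Hom C a b. inv_arr C f \<cdot> (f \<cdot> x) = x"
    using cmp_assoc[OF _ f' i(1)] i(2) idt_cmp by metis
  show "(\<lambda>x. inv_arr C f \<cdot> x) ` Hom C a c \<subseteq> Hom C a b"
    using cmp_Hom[OF _ i(1)] by blast
  show "(\<lambda>x. f \<cdot> x) ` Hom C a b \<subseteq> Hom C a c"
    using cmp_Hom[OF _ f'] by blast
qed

text \<open>Serves to replace the pullback of the unit object by the unit object, the last step of
  \<open>adj_transpose\<close>.\<close>

lemma (in category) precmp_Iso_bij: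
  assumes f: "f \<in> Iso C a b"
  shows "bij_betw (\<lambda>x. x \<cdot> f) (Hom C b c) (Hom C a c)"
proof (rule bij_betw_byWitness[where f' = "\<lambda>x. x \<cdot> inv_arr C f"])
  note i = inv_arr_Iso[OF f] and f' = Iso_Hom[OF f]
  show "\<forall>x \<in> Hom C b c. x \<cdot> f \<cdot> inv_arr C f = x"
    using cmp_assoc[OF i(1) f'] i(3) cmp_idt by metis
  show "\<forall>x \<in> Hom C a c. x \<cdot> inv_arr C f \<cdot> f = x"
    using cmp_assoc[OF f' i(1)] i(2) cmp_idt by metis
  show "(\<lambda>x. x \<cdot> f) ` Hom C b c \<subseteq> Hom C a c"
    using cmp_Hom[OF f'] by blast
  show "(\<lambda>x. x \<cdot> inv_arr C f) ` Hom C a c \<subseteq> Hom C b c"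
    using cmp_Hom[OF i(1)] by blast
qed

text \<open>The usual Hom-set bijection, with inverse \<open>farr G y \<cdot> \<eta> a\<close>: each
  round trip is naturality of the unit or counit followed by one triangle identity.\<close>

lemma (in adjunction) transpose_bij:
  assumes a: "a \<in> objs C" and p: "p \<in> objs D"
  shows "bij_betw (\<lambda>x. \<epsilon> p \<cdot>\<^bsub>D\<^esub> farr F x) (Hom C a (fobj G p)) (Hom D (fobj F a) p)"
proof (rule bij_betw_byWitness[where f' = "\<lambda>y. farr G y \<cdot>\<^bsub>C\<^esub> \<eta> a"])
  have Gp: "fobj G p \<in> objs C" by (rule G.fobj_objs[OF p])
  have Fa: "fobj F a \<in> objs D" by (rule F.fobj_objs[OF a])
  show "\<forall>x \<in> Hom C a (fobj G p). farr G (\<epsilon> p \<cdot>\<^bsub>D\<^esub> farr F x) \<cdot>\<^bsub>C\<^esub> \<eta> a = x"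
  proof
    fix x assume x: "x \<in> Hom C a (fobj G p)"
    note Fx = F.farr_Hom[OF x]
    note e = counit_Hom[OF p]
    have "farr G (\<epsilon> p \<cdot>\<^bsub>D\<^esub> farr F x) \<cdot>\<^bsub>C\<^esub> \<eta> a
        = farr G (\<epsilon> p) \<cdot>\<^bsub>C\<^esub> (farr G (farr F x) \<cdot>\<^bsub>C\<^esub> \<eta> a)"
      by (simp add: G.farr_cmp[OF Fx e]
          F.C.cmp_assoc[OF unit_Hom[OF a] G.farr_Hom[OF Fx] G.farr_Hom[OF e]])
    also have "\<dots> = farr G (\<epsilon> p) \<cdot>\<^bsub>C\<^esub> \<eta> (fobj G p) \<cdot>\<^bsub>C\<^esub> x"
      by (simp add: unit_natural[OF x] F.C.cmp_assoc[OF x unit_Hom[OF Gp] G.farr_Hom[OF e]])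
    also have "\<dots> = x"
      by (simp add: triangle_right[OF p] F.C.idt_cmp[OF x])
    finally show "farr G (\<epsilon> p \<cdot>\<^bsub>D\<^esub> farr F x) \<cdot>\<^bsub>C\<^esub> \<eta> a = x" .
  qed
  show "\<forall>y \<in> Hom D (fobj F a) p. \<epsilon> p \<cdot>\<^bsub>D\<^esub> farr F (farr G y \<cdot>\<^bsub>C\<^esub> \<eta> a) = y"
  proof
    fix y assume y: "y \<in> Hom D (fobj F a) p"
    note Gy = G.farr_Hom[OF y]
    note n = unit_Hom[OF a]
    have "\<epsilon> p \<cdot>\<^bsub>D\<^esub> farr F (farr G y \<cdot>\<^bsub>C\<^esub> \<eta> a)
        = \<epsilon> p \<cdot>\<^bsub>D\<^esub> farr F (farr G y) \<cdot>\<^bsub>D\<^esub> farr F (\<eta> a)"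
      by (simp add: F.farr_cmp[OF n Gy]
          F.D.cmp_assoc[OF F.farr_Hom[OF n] F.farr_Hom[OF Gy] counit_Hom[OF p]])
    also have "\<dots> = y \<cdot>\<^bsub>D\<^esub> (\<epsilon> (fobj F a) \<cdot>\<^bsub>D\<^esub> farr F (\<eta> a))"
      by (simp add: counit_natural[OF y] F.D.cmp_assoc[OF F.farr_Hom[OF n] counit_Hom[OF Fa] y])
    also have "\<dots> = y"
      by (simp add: triangle_left[OF a] F.D.cmp_idt[OF y])
    finally show "\<epsilon> p \<cdot>\<^bsub>D\<^esub> farr F (farr G y \<cdot>\<^bsub>C\<^esub> \<eta> a) = y" .
  qed
  show "(\<lambda>x. \<epsilon> p \<cdot>\<^bsub>D\<^esub> farr F x) ` Hom C a (fobj G p) \<subseteq> Hom D (fobj F a) p"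
    using F.D.cmp_Hom[OF F.farr_Hom counit_Hom[OF p]] by blast
  show "(\<lambda>y. farr G y \<cdot>\<^bsub>C\<^esub> \<eta> a) ` Hom D (fobj F a) p \<subseteq> Hom C a (fobj G p)"
    using F.C.cmp_Hom[OF unit_Hom[OF a] G.farr_Hom] by blast
qed

section \<open>Abelian groups of arrows and composition with a fixed arrow\<close>

lemma HomG_simps [simp]:
  "carrier (HomG C a b) = Hom C a b"
  "x \<otimes>\<^bsub>HomG C a b\<^esub> y = add_arr C x y"
  "\<one>\<^bsub>HomG C a b\<^esub> = zero_arr C a b"
  by (simp_all add: HomG_def)

context additive_category
begin

lemma HomG_group:
  assumes "a \<in> objs C" "b \<in> objs C"
  shows "group (HomG C a b)"
  using HomG_comm_group[OF assms] by (simp add: comm_group_def)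

lemma zero_arr_Hom: "a \<in> objs C \<Longrightarrow> b \<in> objs C \<Longrightarrow> zero_arr C a b \<in> Hom C a b"
  using group.is_monoid[OF HomG_group, THEN monoid.one_closed] by simp

lemma postcmp_group_hom:
  assumes a: "a \<in> objs C" and g: "g \<in> Hom C b c"
  shows "group_hom (HomG C a b) (HomG C a c) (\<lambda>x. g \<cdot> x)"
  using Hom_objs[OF category_axioms g] a
  by (auto simp: group_hom_def group_hom_axioms_def hom_def HomG_group cmp_add_right[OF _ _ g]
      intro: cmp_Hom[OF _ g])

lemma precmp_group_hom:
  assumes c: "c \<in> objs C" and f: "f \<in> Hom C a b"
  shows "group_hom (HomG C b c) (HomG C a c) (\<lambda>x. x \<cdot> f)"
  using Hom_objs[OF category_axioms f] c
  by (auto simp: group_hom_def group_hom_axioms_def hom_def HomG_group cmp_add_left[OF f]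
      intro: cmp_Hom[OF f])

lemma cmp_zero: "a \<in> objs C \<Longrightarrow> g \<in> Hom C b c \<Longrightarrow> g \<cdot> zero_arr C a b = zero_arr C a c"
  using group_hom.hom_one[OF postcmp_group_hom] by simp

lemma zero_cmp: "c \<in> objs C \<Longrightarrow> f \<in> Hom C a b \<Longrightarrow> zero_arr C b c \<cdot> f = zero_arr C a c"
  using group_hom.hom_one[OF precmp_group_hom] by simp

text \<open>\<open>neg_arr\<close> takes its group from the source and target of the arrow;
  membership in a Hom set fixes these endpoints.\<close>

lemma neg_arr_eq: "f \<in> Hom C a b \<Longrightarrow> neg_arr C f = inv\<^bsub>HomG C a b\<^esub> f"
  by (auto simp: neg_arr_def Hom_def)

lemma neg_arr_Hom:
  assumes f: "f \<in> Hom C a b"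
  shows "neg_arr C f \<in> Hom C a b"
  using group.inv_closed[OF HomG_group[OF Hom_objs[OF category_axioms f]], of f] f
  by (simp add: neg_arr_eq[OF f])

lemma neg_arr_neg:
  assumes f: "f \<in> Hom C a b"
  shows "neg_arr C (neg_arr C f) = f"
  using group.inv_inv[OF HomG_group[OF Hom_objs[OF category_axioms f]], of f] f
  by (simp add: neg_arr_eq[OF f] neg_arr_eq[OF neg_arr_Hom[OF f], unfolded neg_arr_eq[OF f]])

lemma neg_zero: "a \<in> objs C \<Longrightarrow> b \<in> objs C \<Longrightarrow> neg_arr C (zero_arr C a b) = zero_arr C a b"
  using neg_arr_eq[OF zero_arr_Hom] group.is_monoid[OF HomG_group, THEN monoid.inv_one]
  by simp

lemma cmp_neg:
  assumes f: "f \<in> Hom C a b" and g: "g \<in> Hom C b c"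
  shows "g \<cdot> neg_arr C f = neg_arr C (g \<cdot> f)"
  using group_hom.hom_inv[OF postcmp_group_hom[OF Hom_objs(1)[OF category_axioms f] g], of f]
    f g neg_arr_eq[OF f] neg_arr_eq[OF cmp_Hom[OF f g]]
  by simp

lemma neg_cmp:
  assumes f: "f \<in> Hom C a b" and g: "g \<in> Hom C b c"
  shows "neg_arr C g \<cdot> f = neg_arr C (g \<cdot> f)"
  using group_hom.hom_inv[OF precmp_group_hom[OF Hom_objs(2)[OF category_axioms g] f], of g]
    f g neg_arr_eq[OF g] neg_arr_eq[OF cmp_Hom[OF f g]]
  by simp

end

lemma (in additive_functor) farr_group_hom:
  assumes "a \<in> objs C" "b \<in> objs C"
  shows "group_hom (HomG C a b) (HomG D (fobj F a) (fobj F b)) (farr F)"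
  using assms
  by (auto simp: group_hom_def group_hom_axioms_def hom_def C.HomG_group D.HomG_group
      fobj_objs farr_add intro: farr_Hom)

lemma (in additive_functor) farr_zero:
  assumes "a \<in> objs C" "b \<in> objs C"
  shows "farr F (zero_arr C a b) = zero_arr D (fobj F a) (fobj F b)"
  using group_hom.hom_one[OF farr_group_hom[OF assms]] by simp

section \<open>Exactness of \<open>Hom(t, -)\<close> on distinguished triangles\<close>

context triangulated_category
begin

section \<open>The strict shift action on objects and arrows\<close>

lemma shift_objs: "a \<in> objs C \<Longrightarrow> shobj C n a \<in> objs C"
  using covariant_functor.fobj_objs[OF additive_functor.axioms(1)[OF shift_additive[of n]]]
  by (simp add: shift_def)

lemma shift_Hom: "f \<in> Hom C a b \<Longrightarrow> sharr C n f \<in> Hom C (shobj C n a) (shobj C n b)"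
  using covariant_functor.farr_Hom[OF additive_functor.axioms(1)[OF shift_additive[of n]]]
  by (simp add: shift_def)

lemma shift_idt: "a \<in> objs C \<Longrightarrow> sharr C n (idt C a) = idt C (shobj C n a)"
  using covariant_functor.farr_idt[OF additive_functor.axioms(1)[OF shift_additive[of n]]]
  by (simp add: shift_def)

lemma shift_cmp:
  "f \<in> Hom C a b \<Longrightarrow> g \<in> Hom C b c \<Longrightarrow> sharr C n (g \<cdot> f) = sharr C n g \<cdot> sharr C n f"
  using covariant_functor.farr_cmp[OF additive_functor.axioms(1)[OF shift_additive[of n]]]
  by (simp add: shift_def)

lemma shift_zero:
  "a \<in> objs C \<Longrightarrow> b \<in> objs C
    \<Longrightarrow> sharr C n (zero_arr C a b) = zero_arr C (shobj C n a) (shobj C n b)"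
  using additive_functor.farr_zero[OF shift_additive[of n]]
  by (simp add: shift_def)

lemma unshift_obj: "a \<in> objs C \<Longrightarrow> m + n = 0 \<Longrightarrow> shobj C m (shobj C n a) = a"
  by (simp add: shobj_shobj shobj_0)

lemma unshift_arr: "f \<in> Hom C a b \<Longrightarrow> m + n = 0 \<Longrightarrow> sharr C m (sharr C n f) = f"
  by (simp add: sharr_sharr sharr_0 Hom_def)

lemma dist_rotateD:
  assumes "(f, g, h) \<in> dist C"
  shows "(g, h, neg_arr C (sharr C 1 f)) \<in> dist C"
  using assms dist_triangle dist_rotate by blast

text \<open>Map the identity triangle
  \<open>a \<rightarrow> a \<rightarrow> z \<rightarrow> a[1]\<close> to the given one by
  \<open>idt C a\<close> and \<open>f\<close>. The third component \<open>w\<close> gives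
  \<open>g \<cdot> f = w \<cdot> 0\<close>.\<close>

lemma dist_cmp_zero:
  assumes t: "(f, g, h) \<in> dist C" and f: "f \<in> Hom C a b" and g: "g \<in> Hom C b c"
  shows "g \<cdot> f = zero_arr C a c"
proof -
  obtain z where z: "zero_object C z" using zero_object_exists by blast
  then have zo: "z \<in> objs C" by (simp add: zero_object_def)
  note a = Hom_objs(1)[OF category_axioms f]
  have h: "src C h = c"
    using dist_triangle[OF t] g by (auto simp: is_triangle_def Hom_def)
  have zero: "zero_arr C z (shobj C 1 a) \<in> Hom C z (shobj C 1 a)"
    by (rule zero_arr_Hom[OF zo shift_objs[OF a]])
  have "idt C a \<in> Hom C a a" by (rule idt_Hom[OF a])
  then obtain w where "w \<in> Hom C z c" "w \<cdot> zero_arr C a z = g \<cdot> f"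
    using dist_morphism[OF dist_idt[OF a z] t, of "idt C a" f] f zero h
    by (auto simp: Hom_def)
  then show ?thesis using cmp_zero[OF a] by force
qed

text \<open>An arrow \<open>x\<close> killed by \<open>g\<close> extends to a morphism from the
  rotated identity triangle of \<open>e\<close> to the rotated given triangle, with \<open>x\<close>
  in first place and zero in second; its third component is the shift of the desired factor.\<close>

lemma dist_factor:
  assumes t: "(f, g, h) \<in> dist C" and f: "f \<in> Hom C a b" and g: "g \<in> Hom C b c"
    and x: "x \<in> Hom C e b" and gx: "g \<cdot> x = zero_arr C e c"
  shows "\<exists>y \<in> Hom C e a. x = f \<cdot> y"
proof -
  obtain z where z: "zero_object C z" using zero_object_exists by blast
  then have zo: "z \<in> objs C" by (simp add: zero_object_def)
  note e = Hom_objs(1)[OF category_axioms x] and c = Hom_objs(2)[OF category_axioms g]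
    and a = Hom_objs(1)[OF category_axioms f]
  note e1 = shift_objs[OF e, of 1]
  let ?id = "idt C (shobj C 1 e)"
  have id: "?id \<in> Hom C (shobj C 1 e) (shobj C 1 e)" by (rule idt_Hom[OF e1])
  \<comment> \<open>Rotation makes the third arrow minus the identity of \<open>e[1]\<close>. The
    target triangle gains a sign in the same place, so the two signs cancel below.\<close>
  have t1: "(zero_arr C e z, zero_arr C z (shobj C 1 e), neg_arr C ?id) \<in> dist C"
    using dist_rotateD[OF dist_idt[OF e z]] by (simp add: shift_idt[OF e])
  note t2 = dist_rotateD[OF t]
  note f1 = shift_Hom[OF f, of 1] and x1 = shift_Hom[OF x, of 1]
  have v: "zero_arr C z c \<in> Hom C z c" by (rule zero_arr_Hom[OF zo c])
  have ez: "zero_arr C e z \<in> Hom C e z" by (rule zero_arr_Hom[OF e zo])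
  have "\<exists>w \<in> Hom C (shobj C 1 e) (shobj C 1 a).
      sharr C 1 x \<cdot> neg_arr C ?id = neg_arr C (sharr C 1 f) \<cdot> w"
    using dist_morphism[OF t1 t2, of x "zero_arr C z c"] x g v ez gx neg_arr_Hom[OF id]
      neg_arr_Hom[OF f1] zero_cmp[OF c ez]
    by (auto simp: Hom_def)
  then obtain w where w: "w \<in> Hom C (shobj C 1 e) (shobj C 1 a)"
    and "sharr C 1 x \<cdot> neg_arr C ?id = neg_arr C (sharr C 1 f) \<cdot> w" by blast
  then have "neg_arr C (sharr C 1 x) = neg_arr C (sharr C 1 f \<cdot> w)"
    by (simp add: cmp_neg[OF id x1] cmp_idt[OF x1] neg_cmp[OF w f1])
  then have "sharr C 1 x = sharr C 1 f \<cdot> w"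
    using neg_arr_neg[OF x1] neg_arr_neg[OF cmp_Hom[OF w f1]] by metis
  \<comment> \<open>Shifts compose strictly, so \<open>[-1]\<close> undoes \<open>[1]\<close> on the
    nose and no comparison isomorphisms enter.\<close>
  then have "sharr C (- 1) (sharr C 1 x) = sharr C (- 1) (sharr C 1 f) \<cdot> sharr C (- 1) w"
    by (simp add: shift_cmp[OF w f1])
  then have "x = f \<cdot> sharr C (- 1) w"
    by (simp add: unshift_arr[OF x] unshift_arr[OF f])
  moreover have "sharr C (- 1) w \<in> Hom C e a"
    using shift_Hom[OF w, of "- 1"] by (simp add: unshift_obj[OF e] unshift_obj[OF a])
  ultimately show ?thesis by blast
qed

text \<open>Shifting \<open>x\<close> by \<open>-n\<close> moves the problem to degree 0 with source
  \<open>e[-n]\<close>. There \<open>dist_factor\<close> applies to the unshifted triangle, and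
  \<open>[n]\<close> brings the factor back.\<close>

lemma shift_dist_factor:
  assumes t: "(f, g, h) \<in> dist C" and f: "f \<in> Hom C a b" and g: "g \<in> Hom C b c"
    and x: "x \<in> Hom C e (shobj C n b)" and gx: "sharr C n g \<cdot> x = zero_arr C e (shobj C n c)"
  shows "\<exists>y \<in> Hom C e (shobj C n a). x = sharr C n f \<cdot> y"
proof -
  note e = Hom_objs(1)[OF category_axioms x] and c = Hom_objs(2)[OF category_axioms g]
    and ab = Hom_objs[OF category_axioms f]
  have x': "sharr C (- n) x \<in> Hom C (shobj C (- n) e) b"
    using shift_Hom[OF x, of "- n"] by (simp add: unshift_obj[OF ab(2)])
  have "g \<cdot> sharr C (- n) x = sharr C (- n) (sharr C n g \<cdot> x)"
    by (simp add: shift_cmp[OF x shift_Hom[OF g]] unshift_arr[OF g])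
  also have "\<dots> = zero_arr C (shobj C (- n) e) c"
    by (simp add: gx shift_zero[OF e shift_objs[OF c]] unshift_obj[OF c])
  finally obtain y where y: "y \<in> Hom C (shobj C (- n) e) a" and xy: "sharr C (- n) x = f \<cdot> y"
    using dist_factor[OF t f g x'] by blast
  have "x = sharr C n (sharr C (- n) x)" by (simp add: unshift_arr[OF x])
  also have "\<dots> = sharr C n f \<cdot> sharr C n y" by (simp add: xy shift_cmp[OF y f])
  finally have "x = sharr C n f \<cdot> sharr C n y" .
  moreover have "sharr C n y \<in> Hom C e (shobj C n a)"
    using shift_Hom[OF y, of n] by (simp add: unshift_obj[OF e])
  ultimately show ?thesis by blast
qed

text \<open>The triangle is rotated twice, which replaces \<open>f[1]\<close> by \<open>- f[1]\<close>; the sign does not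
  affect kernels.\<close>

lemma shift_dist_kernel:
  assumes t: "(f, g, h) \<in> dist C" and f: "f \<in> Hom C a b" and h: "h \<in> Hom C c (shobj C 1 a)"
    and e: "e \<in> objs C"
  shows "{x \<in> Hom C e (shobj C (n + 1) a). sharr C (n + 1) f \<cdot> x = zero_arr C e (shobj C (n + 1) b)}
    = (\<lambda>y. sharr C n h \<cdot> y) ` Hom C e (shobj C n c)"
proof -
  note ab = Hom_objs[OF category_axioms f] and c = Hom_objs(1)[OF category_axioms h]
  let ?m = "neg_arr C (sharr C 1 f)"
  note f1 = shift_Hom[OF f, of 1]
  note m = neg_arr_Hom[OF f1]
  \<comment> \<open>Two rotations give the triangle \<open>(h, -f[1], -g[1])\<close>, in which
    \<open>h\<close> comes first and can be factored through.\<close>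
  note t2 = dist_rotateD[OF dist_rotateD[OF t]]
  have fn: "sharr C n (sharr C 1 f) = sharr C (n + 1) f"
    using f by (simp add: sharr_sharr Hom_def)
  \<comment> \<open>Since \<open>h\<close> ends at \<open>a[1]\<close>, its shift by
    \<open>n\<close> ends at \<open>a[n + 1]\<close>; hence the kernel sits one degree above the
    source of the boundary map.\<close>
  have an: "shobj C n (shobj C 1 a) = shobj C (n + 1) a"
    and bn: "shobj C n (shobj C 1 b) = shobj C (n + 1) b"
    using ab by (simp_all add: shobj_shobj)
  note fn' = shift_Hom[OF f, of "n + 1"]
  note hn = shift_Hom[OF h, of n, unfolded an]
  have mn: "sharr C n ?m = neg_arr C (sharr C (n + 1) f)"
    using group_hom.hom_inv[OF additive_functor.farr_group_hom[OF shift_additive[of n]], of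
        "shobj C 1 a" "shobj C 1 b" "sharr C 1 f"] f1 shift_objs[OF ab(1)] shift_objs[OF ab(2)]
      neg_arr_eq[OF f1] neg_arr_eq[OF shift_Hom[OF f1, of n]]
    by (simp add: shift_def fn)
  show ?thesis
  proof (intro equalityI subsetI)
    fix x
    assume "x \<in> {x \<in> Hom C e (shobj C (n + 1) a).
      sharr C (n + 1) f \<cdot> x = zero_arr C e (shobj C (n + 1) b)}"
    then have x: "x \<in> Hom C e (shobj C (n + 1) a)"
      and fx: "sharr C (n + 1) f \<cdot> x = zero_arr C e (shobj C (n + 1) b)" by auto
    have "sharr C n ?m \<cdot> x = zero_arr C e (shobj C n (shobj C 1 b))"
      by (simp add: mn neg_cmp[OF x fn'] fx neg_zero[OF e shift_objs[OF ab(2)]] bn)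
    then have "\<exists>y \<in> Hom C e (shobj C n c). x = sharr C n h \<cdot> y"
      using x by (intro shift_dist_factor[OF t2 h m]) (simp_all add: an)
    then show "x \<in> (\<lambda>y. sharr C n h \<cdot> y) ` Hom C e (shobj C n c)" by blast
  next
    fix x assume "x \<in> (\<lambda>y. sharr C n h \<cdot> y) ` Hom C e (shobj C n c)"
    then obtain y where y: "y \<in> Hom C e (shobj C n c)" and xy: "x = sharr C n h \<cdot> y" by blast
    have x: "x \<in> Hom C e (shobj C (n + 1) a)" using cmp_Hom[OF y hn] xy by simp
    \<comment> \<open>Conversely, consecutive arrows of the rotated triangle compose to zero;
      shifted by \<open>n\<close>, this shows that \<open>f[n + 1]\<close> annihilates the image of
      \<open>h[n]\<close>.\<close>
    have "?m \<cdot> h = zero_arr C c (shobj C 1 b)" by (rule dist_cmp_zero[OF t2 h m])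
    then have "neg_arr C (sharr C 1 f \<cdot> h) = zero_arr C c (shobj C 1 b)"
      by (simp add: neg_cmp[OF h f1])
    then have fh: "sharr C 1 f \<cdot> h = zero_arr C c (shobj C 1 b)"
      using neg_arr_neg[OF cmp_Hom[OF h f1]] neg_zero[OF c shift_objs[OF ab(2)]] by metis
    have "sharr C (n + 1) f \<cdot> x = sharr C (n + 1) f \<cdot> sharr C n h \<cdot> y"
      by (simp add: xy cmp_assoc[OF y hn fn'])
    also have "\<dots> = sharr C n (sharr C 1 f \<cdot> h) \<cdot> y"
      by (simp add: shift_cmp[OF h f1] fn)
    also have "\<dots> = zero_arr C e (shobj C (n + 1) b)"
      by (simp add: fh shift_zero[OF c shift_objs[OF ab(2)]] bn
          zero_cmp[OF shift_objs[OF ab(2)] y])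
    finally show "x \<in> {x \<in> Hom C e (shobj C (n + 1) a).
        sharr C (n + 1) f \<cdot> x = zero_arr C e (shobj C (n + 1) b)}"
      using x by simp
  qed
qed

end

section \<open>Localisation\<close>

text \<open>A composite of three group isomorphisms: undoing \<open>shcmp\<close>, transposing along
  the adjunction, and precomposing with \<open>unitcmp\<close>. It is applied both to
  \<open>i\<close> with \<open>i\<^sup>! A\<close> and to \<open>j\<close> with
  \<open>j\<^sup>* A\<close>.\<close>

lemma (in coefficient_system) adj_transpose_iso:
  assumes f: "f \<in> Hom (spaces S) Y X" and B: "B \<in> objs (Sh S Y)"
  shows "adj_transpose S f B d
    \<in> Group.iso (coh (Sh S X) (fobj (push S f) B) d) (coh (Sh S Y) B d)"
proof -
  let ?C = "Sh S X" and ?D = "Sh S Y" and ?F = "pull S f" and ?G = "push S f"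
  have src: "src (spaces S) f = Y" "tgt (spaces S) f = X" using f by (auto simp: Hom_def)
  have XY: "X \<in> objs (spaces S)" "Y \<in> objs (spaces S)"
    using Hom_objs[OF spaces_category f] by auto
  interpret C: triangulated_category ?C by (rule Sh_triangulated[OF XY(1)])
  interpret D: triangulated_category ?D by (rule Sh_triangulated[OF XY(2)])
  interpret F: exact_functor ?C ?D ?F by (rule pull_exact[OF f])
  interpret G: exact_functor ?D ?C ?G by (rule push_exact[OF f])
  interpret A: adjunction ?C ?D ?F ?G "pp_unit S f" "pp_counit S f"
    by (rule pull_push_adjunction[OF f])
  let ?t = "tunit ?C" and ?Bd = "shobj ?D d B"
  let ?GB = "shobj ?C d (fobj ?G B)"
  have t: "?t \<in> objs ?C"
    using Sh_monoidal[OF XY(1)] by (rule symmetric_monoidal_category.tunit_objs)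
  have u: "unitcmp ?F \<in> Iso ?D (tunit ?D) (fobj ?F ?t)"
    using pull_monoidal[OF f] by (rule symmetric_monoidal_functor.unitcmp_Iso)
  have Bd: "?Bd \<in> objs ?D" by (rule D.shift_objs[OF B])
  have sc: "shcmp ?G d B \<in> Iso ?C (fobj ?G ?Bd) ?GB" by (rule G.shcmp_Iso[OF B])
  note inv = C.inv_arr_Iso(1)[OF sc]
  let ?p = "\<lambda>x. inv_arr ?C (shcmp ?G d B) \<cdot>\<^bsub>?C\<^esub> x"
  let ?q = "\<lambda>x. pp_counit S f ?Bd \<cdot>\<^bsub>?D\<^esub> farr ?F x"
  let ?r = "\<lambda>x. x \<cdot>\<^bsub>?D\<^esub> unitcmp ?F"
  have p: "?p \<in> Group.iso (HomG ?C ?t ?GB) (HomG ?C ?t (fobj ?G ?Bd))"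
    using group_hom.homh[OF C.postcmp_group_hom[OF t inv]] C.inv_arr_postcmp_bij[OF sc t]
    by (simp add: Group.iso_def)
  \<comment> \<open>Transposition is additive: it is the action of the additive functor
    \<open>?F\<close> on arrows followed by composition with the counit.\<close>
  have "?q \<in> hom (HomG ?C ?t (fobj ?G ?Bd)) (HomG ?D (fobj ?F ?t) ?Bd)"
    using hom_compose[OF group_hom.homh[OF F.farr_group_hom[OF t G.fobj_objs[OF Bd]]]
        group_hom.homh[OF D.postcmp_group_hom[OF F.fobj_objs[OF t] A.counit_Hom[OF Bd]]]]
    by (simp add: comp_def)
  then have q: "?q \<in> Group.iso (HomG ?C ?t (fobj ?G ?Bd)) (HomG ?D (fobj ?F ?t) ?Bd)"
    using A.transpose_bij[OF t Bd] by (simp add: Group.iso_def)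
  have r: "?r \<in> Group.iso (HomG ?D (fobj ?F ?t) ?Bd) (HomG ?D (tunit ?D) ?Bd)"
    using group_hom.homh[OF D.precmp_group_hom[OF Bd D.Iso_Hom[OF u]]] D.precmp_Iso_bij[OF u]
    by (simp add: Group.iso_def)
  have "adj_transpose S f B d = ?r \<circ> (?q \<circ> ?p)"
    by (auto simp: adj_transpose_def src Let_def fun_eq_iff)
  then show ?thesis
    using iso_set_trans[OF iso_set_trans[OF p q] r] by (simp add: coh_def)
qed

theorem lemma4p3:
  fixes S :: "('s, 'f, 'o, 'm) coefficients"
    and R :: "('o, 'm) recollement_data"
    and i j :: 'f and X Z U :: 's and A :: 'o and d :: int and c :: 'm
  assumes "coefficient_system S"
    and "i \<in> Hom (spaces S) Z X" and "i \<in> closed_imm S"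
    and "j \<in> Hom (spaces S) U X" and "(i, j) \<in> open_compl S"
    and "recollement S i j R"
    and "A \<in> objs (Sh S X)"
    and "c \<in> carrier (cohomology S X A d)"
    and "restrict_coh S j A d c = \<one>\<^bsub>cohomology S U (fobj (pull S j) A) d\<^esub>"
  shows "Lift S i R A d c \<noteq> {}
    \<and> ker_forg S i R A d = im_bdry S j R A (d - 1)
    \<and> translation_torsor (supp_cohomology S i R A d) (ker_forg S i R A d) (Lift S i R A d c)
    \<and> (\<forall>x \<in> Lift S i R A d c. \<forall>y \<in> Lift S i R A d c.
        \<exists>!k. k \<in> im_bdry S j R A (d - 1) \<and> y = k \<otimes>\<^bsub>supp_cohomology S i R A d\<^esub> x)
    \<and> translation_torsor (cohomology S Z (fobj (ishriek R) A) d)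
        (adj S i R A d ` im_bdry S j R A (d - 1)) (Loc_tor S i R A d c)"
proof -
  interpret S: coefficient_system S by fact
  let ?C = "Sh S X" and ?D = "Sh S Z" and ?E = "Sh S U"
  have ends: "src (spaces S) i = Z" "tgt (spaces S) i = X"
      "src (spaces S) j = U" "tgt (spaces S) j = X"
    using assms(2,4) by (auto simp: Hom_def)
  have objs: "X \<in> objs (spaces S)" "Z \<in> objs (spaces S)" "U \<in> objs (spaces S)"
    using Hom_objs[OF S.spaces_category assms(2)] Hom_objs[OF S.spaces_category assms(4)] by auto
  interpret C: triangulated_category ?C by (rule S.Sh_triangulated[OF objs(1)])
  interpret D: triangulated_category ?D by (rule S.Sh_triangulated[OF objs(2)])
  interpret E: triangulated_category ?E by (rule S.Sh_triangulated[OF objs(3)])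
  interpret I: adjunction ?D ?C "push S i" "ishriek R" "i_unit R" "i_counit R"
    using recollement.i_adjunction[OF assms(6)] by (simp add: ends)
  interpret J: adjunction ?C ?E "pull S j" "push S j" "pp_unit S j" "pp_counit S j"
    by (rule S.pull_push_adjunction[OF assms(4)])
  have A: "A \<in> objs ?C" by fact
  have tri: "(i_counit R A, pp_unit S j A, bdry_up R A) \<in> dist ?C"
    using recollement.up_dist[OF assms(6)] A by (simp add: ends)
  let ?K = "fobj (push S i) (fobj (ishriek R) A)"
  let ?B = "fobj (pull S j) A"
  let ?Q = "fobj (push S j) ?B"
  let ?t = "tunit ?C"
  note eps = I.counit_Hom[OF A] and eta = J.unit_Hom[OF A]
  \<comment> \<open>The triangle fixes the endpoints: the boundary arrow starts where the unit ends
    and ends at the shift of the source of the counit.\<close>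
  have bd: "bdry_up R A \<in> Hom ?C ?Q (shobj ?C 1 ?K)"
    using C.dist_triangle[OF tri] eps eta by (auto simp: is_triangle_def Hom_def)
  have B: "?B \<in> objs ?E" by (rule J.F.fobj_objs[OF A])
  have t: "?t \<in> objs ?C"
    using S.Sh_monoidal[OF objs(1)] by (rule symmetric_monoidal_category.tunit_objs)

  \<comment> \<open>The forgetful map as composition with the shifted counit\<close>
  let ?H = "HomG ?C ?t (shobj ?C d ?K)" and ?HA = "HomG ?C ?t (shobj ?C d A)"
  have supp: "supp_cohomology S i R A d = ?H"
    by (simp add: supp_cohomology_def coh_def ends)
  have coh: "cohomology S X A d = ?HA"
    by (simp add: cohomology_def coh_def)
  have forg: "forg S i R A d = (\<lambda>x. sharr ?C d (i_counit R A) \<cdot>\<^bsub>?C\<^esub> x)"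
    by (simp add: forg_def Let_def ends fun_eq_iff)
  interpret forg: group_hom ?H ?HA "forg S i R A d"
    unfolding forg by (rule C.postcmp_group_hom[OF t C.shift_Hom[OF eps]])

  have c: "c \<in> Hom ?C ?t (shobj ?C d A)" using assms(8) by (simp add: coh)
  note eta_d = C.shift_Hom[OF eta, of d]
  have isoj: "adj_transpose S j ?B n \<in> Group.iso (coh ?C ?Q n) (coh ?E ?B n)" for n
    by (rule S.adj_transpose_iso[OF assms(4) B])

  have "sharr ?C d (pp_unit S j A) \<cdot>\<^bsub>?C\<^esub> c = zero_arr ?C ?t (shobj ?C d ?Q)"
  proof -
    have grp: "group (coh ?C ?Q d)" "group (coh ?E ?B d)"
      using C.HomG_group[OF t C.shift_objs] J.G.fobj_objs[OF B]
        E.HomG_group[OF symmetric_monoidal_category.tunit_objs[OF S.Sh_monoidal[OF objs(3)]]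
          E.shift_objs[OF B]]
      by (simp_all add: coh_def)
    interpret T: group_hom "coh ?C ?Q d" "coh ?E ?B d" "adj_transpose S j ?B d"
      using grp isoj[of d] by (simp add: group_hom_def group_hom_axioms_def Group.iso_def)
    \<comment> \<open>\<open>restrict_coh\<close> composes with the shifted unit and then
      transposes, so \<open>j\<^sup>* c = 0\<close> says that this transpose vanishes; injectivity
      removes the transposition.\<close>
    have "adj_transpose S j ?B d (sharr ?C d (pp_unit S j A) \<cdot>\<^bsub>?C\<^esub> c)
        = adj_transpose S j ?B d \<one>\<^bsub>coh ?C ?Q d\<^esub>"
      using assms(9) by (simp add: restrict_coh_def Let_def ends cohomology_def)
    moreover have "inj_on (adj_transpose S j ?B d) (carrier (coh ?C ?Q d))"
      using isoj[of d] by (simp add: Group.iso_def bij_betw_def)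
    moreover have "sharr ?C d (pp_unit S j A) \<cdot>\<^bsub>?C\<^esub> c \<in> carrier (coh ?C ?Q d)"
      using C.cmp_Hom[OF c eta_d] by (simp add: coh_def)
    ultimately have "sharr ?C d (pp_unit S j A) \<cdot>\<^bsub>?C\<^esub> c = \<one>\<^bsub>coh ?C ?Q d\<^esub>"
      using T.G.one_closed by (metis inj_onD)
    then show ?thesis by (simp add: coh_def)
  qed
  \<comment> \<open>Exactness at the middle term: \<open>c\<close> is killed by the shifted unit,
    hence factors through the shifted counit, and the factor is a supported refinement.\<close>
  then obtain x where x: "x \<in> Hom ?C ?t (shobj ?C d ?K)" and cx: "forg S i R A d x = c"
    using C.shift_dist_factor[OF tri eps eta c] by (auto simp: forg)

  \<comment> \<open>The kernel of the forgetful map and the image of the boundary map\<close>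
  have ker: "ker_forg S i R A d = kernel ?H ?HA (forg S i R A d)"
    by (simp add: ker_forg_def supp coh ends)
  have im: "ker_forg S i R A d = im_bdry S j R A (d - 1)"
  proof -
    let ?\<phi> = "adj_transpose S j ?B (d - 1)"
    have bij: "bij_betw ?\<phi> (carrier (coh ?C ?Q (d - 1))) (carrier (coh ?E ?B (d - 1)))"
      using isoj[of "d - 1"] by (simp add: Group.iso_def)
    \<comment> \<open>The inverse transpose inside \<open>bdry\<close> is onto, so as the class on
      \<open>U\<close> varies, every arrow from the unit object to
      \<open>(j\<^sub>* j\<^sup>* A)[d - 1]\<close> occurs.\<close>
    have "im_bdry S j R A (d - 1)
        = (\<lambda>y. sharr ?C (d - 1) (bdry_up R A) \<cdot>\<^bsub>?C\<^esub> y)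
          ` the_inv_into (carrier (coh ?C ?Q (d - 1))) ?\<phi> ` carrier (coh ?E ?B (d - 1))"
      by (simp add: im_bdry_def bdry_def Let_def ends cohomology_def image_image)
    also have "\<dots> = (\<lambda>y. sharr ?C (d - 1) (bdry_up R A) \<cdot>\<^bsub>?C\<^esub> y)
        ` Hom ?C ?t (shobj ?C (d - 1) ?Q)"
      using bij_betw_the_inv_into[OF bij] by (simp add: bij_betw_def coh_def)
    \<comment> \<open>Taking \<open>n = d - 1\<close> puts the kernel in degree
      \<open>n + 1 = d\<close>.\<close>
    also have "\<dots> = ker_forg S i R A d"
      using C.shift_dist_kernel[OF tri eps bd t, of "d - 1"]
      by (simp add: ker kernel_def forg)
    finally show ?thesis by simp
  qed

  \<comment> \<open>The lifts as a coset of the kernel\<close>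
  have lift: "Lift S i R A d c = ker_forg S i R A d #>\<^bsub>?H\<^esub> x"
    using forg.fibre_eq_kernel_coset[of x] x
    by (simp add: Lift_def supp ker cx)
  have sub: "subgroup (ker_forg S i R A d) ?H"
    unfolding ker by (rule forg.subgroup_kernel)
  have tors: "translation_torsor ?H (ker_forg S i R A d) (Lift S i R A d c)"
    unfolding lift by (rule forg.G.translation_torsor_r_coset[OF sub]) (simp add: x)

  have diff: "\<exists>!k. k \<in> ker_forg S i R A d \<and> z = k \<otimes>\<^bsub>?H\<^esub> y"
    if y: "y \<in> Lift S i R A d c" and z: "z \<in> Lift S i R A d c" for y z
  proof -
    have yz: "y \<in> carrier ?H" "z \<in> carrier ?H" "forg S i R A d y = forg S i R A d z"
      using y z by (simp_all add: Lift_def supp)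
    \<comment> \<open>The fibre is described through \<open>y\<close> rather than the chosen lift
      \<open>x\<close>, which exposes the difference of the two given lifts; cancellation makes it
      unique.\<close>
    have "z \<in> ker_forg S i R A d #>\<^bsub>?H\<^esub> y"
      using forg.fibre_eq_kernel_coset[OF yz(1)] yz ker by auto
    then obtain k where k: "k \<in> ker_forg S i R A d" "z = k \<otimes>\<^bsub>?H\<^esub> y"
      by (auto simp: r_coset_def)
    moreover have "l = k" if "l \<in> ker_forg S i R A d" "z = l \<otimes>\<^bsub>?H\<^esub> y" for l
      using that k yz(1) forg.G.right_cancel subgroup.mem_carrier[OF sub] by metis
    ultimately show ?thesis by blast
  qed

  \<comment> \<open>Transport along the adjunction to the closed part\<close>
  let ?HZ = "cohomology S Z (fobj (ishriek R) A) d"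
  have A': "fobj (ishriek R) A \<in> objs ?D" by (rule I.G.fobj_objs[OF A])
  have "adj S i R A d \<in> hom ?H ?HZ"
    using S.adj_transpose_iso[OF assms(2) A', of d]
    by (simp add: adj_def cohomology_def coh_def Group.iso_def)
  moreover have "group ?HZ"
    using D.HomG_group[OF symmetric_monoidal_category.tunit_objs[OF S.Sh_monoidal[OF objs(2)]]
        D.shift_objs[OF A']]
    by (simp add: cohomology_def coh_def)
  ultimately interpret adj: group_hom ?H ?HZ "adj S i R A d"
    by (simp add: group_hom_def group_hom_axioms_def forg.G.is_group)
  \<comment> \<open>The homomorphism \<open>adj\<close> sends the coset through \<open>x\<close> to
    a coset of the image subgroup, so the coset-torsor lemma applies again in the target
    group.\<close>
  have "Loc_tor S i R A d c = adj S i R A d ` ker_forg S i R A d #>\<^bsub>?HZ\<^esub> adj S i R A d x"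
    unfolding Loc_tor_def lift
    by (rule adj.image_r_coset) (use x subgroup.subset[OF sub] in auto)
  then have "translation_torsor ?HZ (adj S i R A d ` ker_forg S i R A d) (Loc_tor S i R A d c)"
    using adj.H.translation_torsor_r_coset[OF adj.subgroup_img_is_subgroup[OF sub]]
      adj.hom_closed[of x] x by simp
  moreover have "Lift S i R A d c \<noteq> {}"
    using x cx by (auto simp: Lift_def supp)
  ultimately show ?thesis
    using tors diff im by (simp add: supp)
qed

end
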